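(* For every integer $g\ge1$ there is a one-to-one correspondence between $\mathcal G(g)$ and $\mathcal A(g)'$. In particular, $|\mathcal G(g)|=A_g'$ and $\gamma_g=A_g'/2^{g-1}$.
   Context: All intervals are intervals of integers. A numerical set is a cofinite subset $S\subseteq\mathbb N=\{0,1,2,\dots\}$ containing $0$; for $S\ne\mathbb N$ its Frobenius number is $\max(\mathbb N-S)$. Its atom monoid is $A(S)=\{n\in\mathbb Z: n+S\subseteq S\}$. For $g\ge1$, $\mathcal S(g)$ is the set of numerical sets with Frobenius number $g$ (so $|\mathcal S(g)|=2^{g-1}$), $\mathcal G(g)=\{S\in\mathcal S(g): A(S)=\{0\}\cup(g,\infty)\}$, and $\gamma_g=|\mathcal G(g)|/|\mathcal S(g)|$. For $k\ge1$, $\mathcal A(k)'$ is the collection of all subsets $L\subseteq(0,k)$ such that for each $x\in L$ there is $y\in L$ with $x+y\le k$ and $x+y\notin L$; $A_k'=|\mathcal A(k)'|$. *)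

theory Defs
  imports Complex_Main
begin

definition numerical_set :: "nat set \<Rightarrow> bool" where
  "numerical_set S \<longleftrightarrow> 0 \<in> S \<and> finite (UNIV - S)"

(* Only meaningful for cofinite S \<noteq> UNIV. *)
definition frobenius_number :: "nat set \<Rightarrow> nat" where
  "frobenius_number S = Max (UNIV - S)"

(* The translating element n ranges over all integers, so S is embedded in the integers. *)
definition atom_monoid :: "nat set \<Rightarrow> int set" where
  "atom_monoid S = {n. (\<lambda>s. n + s) ` (int ` S) \<subseteq> int ` S}"

definition numerical_sets :: "nat \<Rightarrow> nat set set" where
  "numerical_sets g = {S. numerical_set S \<and> S \<noteq> UNIV \<and> frobenius_number S = g}"

definition good_numerical_sets :: "nat \<Rightarrow> nat set set" where
  "good_numerical_sets g = {S \<in> numerical_sets g. atom_monoid S = {0} \<union> {int g<..}}"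

definition gamma_ratio :: "nat \<Rightarrow> real" where
  "gamma_ratio g = real (card (good_numerical_sets g)) / real (card (numerical_sets g))"

(* The collection A(k)'; its members lie in (0,k), so natural numbers suffice. *)
definition A_prime :: "nat \<Rightarrow> nat set set" where
  "A_prime k = {L. L \<subseteq> {0<..<k} \<and> (\<forall>x\<in>L. \<exists>y\<in>L. x + y \<le> k \<and> x + y \<notin> L)}"

end

theory Submission
  imports Defs
begin

text \<open>The correspondence is S \<mapsto> S \<inter> (0,g). Since 0 lies in S, g does not, and
  everything above g does, this trace L determines S and can be any subset of (0,g); hence the count
  2^(g-1). The atom monoid always contains 0 and (g,\<infinity>), and 0 \<in> S forces it inside S.
  So S is good iff no x in L is an atom, that is, iff each x in L has some s in S with x + s outside
  S. Such an s must itself lie in L with x + s \<le> g, which is the condition defining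
  \<open>A_prime g\<close>. Thus \<open>mem_good_numerical_sets_iff\<close> identifies the good sets
  by their traces, and the bijection of \<open>bij_betw_numerical_sets\<close> restricts.\<close>

lemma mem_numerical_sets_iff:
  "S \<in> numerical_sets g \<longleftrightarrow> 0 \<in> S \<and> g \<notin> S \<and> {g<..} \<subseteq> S"
proof
  assume "S \<in> numerical_sets g"
  then have zero: "0 \<in> S" and fin: "finite (- S)" and ne: "- S \<noteq> {}" and max: "Max (- S) = g"
    by (auto simp: numerical_sets_def numerical_set_def frobenius_number_def Compl_eq_Diff_UNIV)
  have "g \<in> - S"
    using Max_in[OF fin ne] max by simp
  moreover have "n \<in> S" if "g < n" for n
    using Max_ge[OF fin, of n] max that by auto
  ultimately show "0 \<in> S \<and> g \<notin> S \<and> {g<..} \<subseteq> S"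
    using zero by auto
next
  assume S: "0 \<in> S \<and> g \<notin> S \<and> {g<..} \<subseteq> S"
  then have sub: "- S \<subseteq> {..g}"
    using linorder_not_less by auto
  then have fin: "finite (- S)"
    using finite_subset by blast
  have "Max (- S) = g"
    using S sub by (intro Max_eqI[OF fin]) auto
  then show "S \<in> numerical_sets g"
    using S fin
    by (auto simp: numerical_sets_def numerical_set_def frobenius_number_def Compl_eq_Diff_UNIV)
qed

lemma bij_betw_numerical_sets:
  assumes "g \<ge> 1"
  shows "bij_betw (\<lambda>S. S \<inter> {0<..<g}) (numerical_sets g) (Pow {0<..<g})"
\<comment> \<open>The inverse restores the forced elements; g \<ge> 1 ensures that the restored 0 is
  not the excluded g.\<close>
proof (rule bij_betw_byWitness[where f' = "\<lambda>L. {0} \<union> L \<union> {g<..}"])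
  show "\<forall>S\<in>numerical_sets g. {0} \<union> S \<inter> {0<..<g} \<union> {g<..} = S"
  proof
    fix S assume "S \<in> numerical_sets g"
    then have S: "0 \<in> S" "g \<notin> S" "{g<..} \<subseteq> S"
      by (auto simp: mem_numerical_sets_iff)
    have "n \<in> {0} \<union> S \<inter> {0<..<g} \<union> {g<..} \<longleftrightarrow> n \<in> S" for n
      using S by (cases "n < g"; cases "n = g") auto
    then show "{0} \<union> S \<inter> {0<..<g} \<union> {g<..} = S" by blast
  qed
qed (use assms in \<open>auto simp: mem_numerical_sets_iff\<close>)

lemma card_numerical_sets:
  assumes "g \<ge> 1"
  shows "card (numerical_sets g) = 2 ^ (g - 1)"
  using bij_betw_same_card[OF bij_betw_numerical_sets[OF assms]] by (simp add: card_Pow)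

text \<open>Translating the element 0 of S shows that every atom n = n + 0 already lies in S.
  Negative translations are thus excluded, and the argument can continue in the naturals.\<close>

lemma atom_monoid_eq:
  assumes "0 \<in> S"
  shows "atom_monoid S = int ` {n \<in> S. \<forall>s\<in>S. n + s \<in> S}"
proof (intro set_eqI iffI)
  fix m assume m: "m \<in> atom_monoid S"
  then have shift: "m + int s \<in> int ` S" if "s \<in> S" for s
    using that by (auto simp: atom_monoid_def)
  from shift[OF assms] obtain n where n: "n \<in> S" "m = int n"
    by auto
  have "n + s \<in> S" if "s \<in> S" for s
    using shift[OF that] n(2) by (auto simp flip: of_nat_add)
  with n show "m \<in> int ` {n \<in> S. \<forall>s\<in>S. n + s \<in> S}"
    by blast
qed (auto simp: atom_monoid_def simp flip: of_nat_add)

lemma mem_good_numerical_sets_iff: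
  assumes "S \<in> numerical_sets g"
  shows "S \<in> good_numerical_sets g \<longleftrightarrow> S \<inter> {0<..<g} \<in> A_prime g"
proof -
  have S: "0 \<in> S" "g \<notin> S" "\<And>n. g < n \<Longrightarrow> n \<in> S"
    using assms by (auto simp: mem_numerical_sets_iff)
  have "{0} \<union> {int g<..} = int ` ({0} \<union> {g<..})"
  proof (intro set_eqI iffI)
    fix m assume "m \<in> {0} \<union> {int g<..}"
    then show "m \<in> int ` ({0} \<union> {g<..})"
      by (intro image_eqI[of _ _ "nat m"]) auto
  qed auto
  \<comment> \<open>Both sides of the defining equation are images under the injection
    \<open>int\<close>, which can therefore be cancelled.\<close>
  then have "S \<in> good_numerical_sets g \<longleftrightarrow>
      {n \<in> S. \<forall>s\<in>S. n + s \<in> S} = {0} \<union> {g<..}"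
    using assms
    by (simp only: good_numerical_sets_def mem_Collect_eq atom_monoid_eq[OF S(1)]
        inj_image_eq_iff[OF inj_of_nat] simp_thms)
  also have "\<dots> \<longleftrightarrow> (\<forall>x\<in>S \<inter> {0<..<g}. \<exists>s\<in>S. x + s \<notin> S)"
  proof
    assume eq: "{n \<in> S. \<forall>s\<in>S. n + s \<in> S} = {0} \<union> {g<..}"
    show "\<forall>x\<in>S \<inter> {0<..<g}. \<exists>s\<in>S. x + s \<notin> S"
    proof
      fix x assume x: "x \<in> S \<inter> {0<..<g}"
      then have "x \<notin> {n \<in> S. \<forall>s\<in>S. n + s \<in> S}"
        unfolding eq by auto
      with x show "\<exists>s\<in>S. x + s \<notin> S" by blast
    qed
  next
    assume escape: "\<forall>x\<in>S \<inter> {0<..<g}. \<exists>s\<in>S. x + s \<notin> S"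
    have "n \<in> {0} \<union> {g<..}" if "n \<in> S" "\<forall>s\<in>S. n + s \<in> S" for n
      using escape S(2) that by (cases "n < g"; cases "n = g") auto
    \<comment> \<open>The reverse inclusion is automatic: 0 fixes S, and any n > g moves S into
      (g,\<infinity>).\<close>
    with S show "{n \<in> S. \<forall>s\<in>S. n + s \<in> S} = {0} \<union> {g<..}"
      by auto
  qed
  also have "\<dots> \<longleftrightarrow> S \<inter> {0<..<g} \<in> A_prime g"
  proof -
    have "(\<exists>s\<in>S. x + s \<notin> S) \<longleftrightarrow>
        (\<exists>y\<in>S \<inter> {0<..<g}. x + y \<le> g \<and> x + y \<notin> S \<inter> {0<..<g})"
      if x: "x \<in> S \<inter> {0<..<g}" for x
    proof
      assume "\<exists>s\<in>S. x + s \<notin> S"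
      then obtain s where s: "s \<in> S" "x + s \<notin> S" by blast
      \<comment> \<open>s = 0 would give x + s = x \<in> S. Together with x > 0 and x + s \<le> g,
        this places s in (0,g).\<close>
      have "s > 0"
        using s x by (cases s) auto
      moreover have "x + s \<le> g"
        using s(2) S(3) linorder_not_less by blast
      ultimately show "\<exists>y\<in>S \<inter> {0<..<g}. x + y \<le> g \<and> x + y \<notin> S \<inter> {0<..<g}"
        using s x S(2) by (intro bexI[of _ s]) auto
    next
      assume "\<exists>y\<in>S \<inter> {0<..<g}. x + y \<le> g \<and> x + y \<notin> S \<inter> {0<..<g}"
      then obtain y where y: "y \<in> S" "y > 0" "x + y \<le> g" "x + y \<notin> S \<inter> {0<..<g}"
        by auto
      \<comment> \<open>A positive sum below g misses S exactly when it misses the trace; the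
        boundary sum g lies outside S as the Frobenius number.\<close>
      then have "x + y \<notin> S"
        using S(2) by (cases "x + y = g") auto
      with y show "\<exists>s\<in>S. x + s \<notin> S" by blast
    qed
    then show ?thesis
      unfolding A_prime_def by blast
  qed
  finally show ?thesis .
qed

theorem theorem10:
  fixes g :: nat
  assumes "g \<ge> 1"
  shows "(\<exists>f. bij_betw f (good_numerical_sets g) (A_prime g))
    \<and> card (good_numerical_sets g) = card (A_prime g)
    \<and> gamma_ratio g = real (card (A_prime g)) / 2 ^ (g - 1)"
proof -
  let ?f = "\<lambda>S. S \<inter> {0<..<g}"
  have bij: "bij_betw ?f (numerical_sets g) (Pow {0<..<g})"
    by (rule bij_betw_numerical_sets[OF assms])
  have good_subset: "good_numerical_sets g \<subseteq> numerical_sets g"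
    by (auto simp: good_numerical_sets_def)
  have "?f ` good_numerical_sets g = A_prime g"
  proof
    show "?f ` good_numerical_sets g \<subseteq> A_prime g"
      using good_subset mem_good_numerical_sets_iff by blast
    show "A_prime g \<subseteq> ?f ` good_numerical_sets g"
    proof
      fix L assume L: "L \<in> A_prime g"
      \<comment> \<open>Any subset of (0,g) is the trace of some numerical set; the trace criterion
        then makes that set good.\<close>
      then have "L \<in> ?f ` numerical_sets g"
        unfolding bij_betw_imp_surj_on[OF bij] by (simp add: A_prime_def)
      with L show "L \<in> ?f ` good_numerical_sets g"
        using mem_good_numerical_sets_iff by blast
    qed
  qed
  then have "bij_betw ?f (good_numerical_sets g) (A_prime g)"
    by (rule bij_betw_subset[OF bij good_subset])
  then show ?thesis
    using bij_betw_same_card by (auto simp: gamma_ratio_def card_numerical_sets[OF assms])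
qed

end
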